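(* Let $f_c\ge1$ be an integer, $n=2f_c+1$, and let $y\in\mathbb C^n$, $y\neq0$. Let $\hat c^{(\mathrm{BME})}$ be a solution of $$\max_{c\in\mathbb C^n}\langle y,c\rangle\quad\text{s.t. }\|\mathcal F_n^*(c)\|_\infty\le1,$$ and set $$\lambda_{\min}(y)=\frac1{\sqrt n\,\|\hat c^{(\mathrm{BME})}\|_2},\qquad\lambda_{\max}(y)=\frac{\|\mathcal F_n^*(y)\|_\infty}{\sqrt n\,\|y\|_2}.$$ Let $\lambda\in\,]\lambda_{\min}(y),\lambda_{\max}(y)]$, let $\hat c$ be a solution of the dual problem of the CBLasso, $$\hat c\in\arg\max\big\{\lambda\langle y,c\rangle:\ c\in\mathbb C^n,\ \|\mathcal F_n^*(c)\|_\infty\le1,\ n\lambda^2\|c\|_2^2\le1\big\},$$ and let $\hat p=\mathcal F_n^*(\hat c)$ be the dual polynomial. Then the function $|\hat p|^2$ is non-constant on $\mathbb T$.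
   Context: $\mathbb T$ is the torus $[0,1]$ with endpoints identified. Coordinates of vectors in $\mathbb C^n$, $n=2f_c+1$, are indexed by $-f_c\le k\le f_c$; $\langle z,z'\rangle=\mathfrak R(z^*z')$. For $c\in\mathbb C^n$, $\mathcal F_n^*(c)$ is the trigonometric polynomial $\mathcal F_n^*(c)(t)=\sum_{k=-f_c}^{f_c}c_k e^{2\pi\imath kt}$ and $\|\cdot\|_\infty$ is the sup norm on $\mathbb T$. $\mathcal F_n^*$ is the adjoint of $\mathcal F_n(\mu)=\big(\int_{\mathbb T}e^{-2\pi\imath kt}\mu(dt)\big)_{|k|\le f_c}$ on the space $E^*$ of complex Borel measures on $\mathbb T$. The CBLasso problem is $$\min_{(\mu,\sigma)\in E^*\times\mathbb R_{++}}\frac1{2n\sigma}\|y-\mathcal F_n(\mu)\|_2^2+\frac\sigma2+\lambda\|\mu\|_{\mathrm{TV}},$$ with the objective extended to $\sigma=0$ by the value $\lambda\|\mu\|_{\mathrm{TV}}$ if $y=\mathcal F_n(\mu)$ and $+\infty$ otherwise. *)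

theory Defs
  imports "HOL-Analysis.Analysis"
begin

text \<open>
  Throughout, \<open>fc\<close> is the cut-off frequency and \<open>n = 2 * fc + 1\<close>.  A vector of
  \<open>\<complex>\<^sup>n\<close>, with coordinates indexed by \<open>-fc \<le> k \<le> fc\<close>, is a function on the integers
  that vanishes outside this index range, so that equality of functions is equality of
  vectors.
\<close>

definition freqs :: "nat \<Rightarrow> int set" where
  "freqs fc = {- int fc..int fc}"

definition dimn :: "nat \<Rightarrow> nat" where
  "dimn fc = 2 * fc + 1"

definition cvecs :: "nat \<Rightarrow> (int \<Rightarrow> complex) set" where
  "cvecs fc = {c. \<forall>k. k \<notin> freqs fc \<longrightarrow> c k = 0}"

definition rinner :: "nat \<Rightarrow> (int \<Rightarrow> complex) \<Rightarrow> (int \<Rightarrow> complex) \<Rightarrow> real" where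
  "rinner fc z z' = Re (\<Sum>k\<in>freqs fc. cnj (z k) * z' k)"

definition norm2 :: "nat \<Rightarrow> (int \<Rightarrow> complex) \<Rightarrow> real" where
  "norm2 fc c = L2_set (\<lambda>k. cmod (c k)) (freqs fc)"

definition trig_poly :: "nat \<Rightarrow> (int \<Rightarrow> complex) \<Rightarrow> real \<Rightarrow> complex" where
  "trig_poly fc c t =
     (\<Sum>k\<in>freqs fc. c k * exp (2 * of_real pi * \<i> * of_int k * of_real t))"

text \<open>
  Functions on the torus are represented by functions of a real variable, considered on
  \<open>{0..1}\<close>; trigonometric polynomials have period one.
\<close>

definition torus :: "real set" where
  "torus = {0..1}"

definition supnorm :: "(real \<Rightarrow> complex) \<Rightarrow> real" where
  "supnorm p = (SUP t\<in>torus. cmod (p t))"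

definition BME_solution :: "nat \<Rightarrow> (int \<Rightarrow> complex) \<Rightarrow> (int \<Rightarrow> complex) \<Rightarrow> bool" where
  "BME_solution fc y =
     is_arg_max (rinner fc y) (\<lambda>c. c \<in> cvecs fc \<and> supnorm (trig_poly fc c) \<le> 1)"

definition CBLasso_dual_solution ::
    "nat \<Rightarrow> (int \<Rightarrow> complex) \<Rightarrow> real \<Rightarrow> (int \<Rightarrow> complex) \<Rightarrow> bool" where
  "CBLasso_dual_solution fc y l =
     is_arg_max (\<lambda>c. l * rinner fc y c)
       (\<lambda>c. c \<in> cvecs fc \<and> supnorm (trig_poly fc c) \<le> 1 \<and>
            real (dimn fc) * l\<^sup>2 * (norm2 fc c)\<^sup>2 \<le> 1)"

text \<open>The first threshold takes the chosen solution of the BME problem as its argument.\<close>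

definition lambda_min :: "nat \<Rightarrow> (int \<Rightarrow> complex) \<Rightarrow> real" where
  "lambda_min fc cBME = 1 / (sqrt (real (dimn fc)) * norm2 fc cBME)"

definition lambda_max :: "nat \<Rightarrow> (int \<Rightarrow> complex) \<Rightarrow> real" where
  "lambda_max fc y = supnorm (trig_poly fc y) / (sqrt (real (dimn fc)) * norm2 fc y)"

lemma trig_poly_periodic: "trig_poly fc c (t + 1) = trig_poly fc c t"
proof -
  have "exp (2 * of_real pi * \<i> * of_int k * of_real (t + 1))
      = exp (2 * of_real pi * \<i> * of_int k * of_real t)" for k :: int
  proof -
    have "exp (2 * of_real pi * \<i> * of_int k) = (1::complex)"
      using exp_integer_2pi[of "of_int k"] by (simp add: mult_ac)
    then show ?thesis
      by (simp add: distrib_left exp_add)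
  qed
  then show ?thesis
    by (simp add: trig_poly_def)
qed

text \<open>The supremum in \<^const>\<open>supnorm\<close> is a genuine one for trigonometric polynomials.\<close>

lemma bdd_above_trig_poly: "bdd_above ((\<lambda>t. cmod (trig_poly fc c t)) ` torus)"
  unfolding torus_def trig_poly_def
  by (intro compact_imp_bounded[THEN bounded_imp_bdd_above] compact_continuous_image
      continuous_intros compact_Icc)

end

theory Submission
  imports Defs
begin

text \<open>
  By Parseval, every feasible point of the BME problem has norm at most \<open>1\<close>, so
  \<open>l > lambda_min fc cBME\<close> forces \<open>n * l\<^sup>2 > 1\<close>, and the dual solution \<open>c\<close> has norm at most
  \<open>r = 1 / (sqrt n * l) < 1\<close>.  If \<open>p = trig_poly fc c\<close> had constant modulus, then, again by
  Parseval, this modulus would be \<open>norm2 fc c < 1\<close>, so the sup norm constraint would be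
  inactive at \<open>c\<close>.  By convexity \<open>c\<close> would then maximise the linear objective on the whole
  ball of radius \<open>r\<close>, that is, \<open>c = r * y / norm2 fc y\<close>, whose polynomial has sup norm
  \<open>lambda_max fc y / l \<ge> 1\<close>: a contradiction.
\<close>

section \<open>Euclidean norm and real inner product of coefficient vectors\<close>

lemma finite_freqs [simp]: "finite (freqs fc)"
  by (simp add: freqs_def)

lemma norm2_nonneg [simp]: "norm2 fc c \<ge> 0"
  by (simp add: norm2_def L2_set_nonneg)

lemma norm2_power2: "(norm2 fc c)\<^sup>2 = (\<Sum>k\<in>freqs fc. (cmod (c k))\<^sup>2)"
  by (simp add: norm2_def L2_set_def sum_nonneg)

lemma norm2_eq_0_iff: "norm2 fc c = 0 \<longleftrightarrow> (\<forall>k\<in>freqs fc. c k = 0)"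
  by (simp add: norm2_def L2_set_eq_0_iff)

lemma norm2_scale: "norm2 fc (\<lambda>k. complex_of_real a * x k) = \<bar>a\<bar> * norm2 fc x"
  by (simp add: norm2_def norm_mult L2_set_left_distrib L2_set_right_distrib)

lemma norm2_triangle: "norm2 fc (\<lambda>k. x k + z k) \<le> norm2 fc x + norm2 fc z"
proof -
  have "norm2 fc (\<lambda>k. x k + z k) \<le> L2_set (\<lambda>k. cmod (x k) + cmod (z k)) (freqs fc)"
    unfolding norm2_def by (intro L2_set_mono norm_triangle_ineq norm_ge_zero)
  also have "\<dots> \<le> norm2 fc x + norm2 fc z"
    unfolding norm2_def by (rule L2_set_triangle_ineq)
  finally show ?thesis .
qed

lemma rinner_add: "rinner fc y (\<lambda>k. x k + z k) = rinner fc y x + rinner fc y z"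
  by (simp add: rinner_def distrib_left sum.distrib)

lemma rinner_scale: "rinner fc y (\<lambda>k. complex_of_real a * x k) = a * rinner fc y x"
proof -
  have "(\<Sum>k\<in>freqs fc. cnj (y k) * (complex_of_real a * x k))
      = complex_of_real a * (\<Sum>k\<in>freqs fc. cnj (y k) * x k)"
    by (simp add: sum_distrib_left mult_ac)
  then show ?thesis
    by (simp add: rinner_def)
qed

lemma rinner_self: "rinner fc y y = (norm2 fc y)\<^sup>2"
  unfolding rinner_def norm2_power2 Re_sum cmod_power2
  by (intro sum.cong refl) (simp add: power2_eq_square)

text \<open>Serves to settle the equality case of Cauchy-Schwarz: a vector in a ball that maximises
  a nonzero linear functional there is identified through its distance to the known
  maximiser.\<close>

lemma norm2_diff_power2:
  "(norm2 fc (\<lambda>k. x k - z k))\<^sup>2 = (norm2 fc x)\<^sup>2 - 2 * rinner fc x z + (norm2 fc z)\<^sup>2"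
proof -
  have "(norm2 fc (\<lambda>k. x k - z k))\<^sup>2
      = (\<Sum>k\<in>freqs fc. (cmod (x k))\<^sup>2 - 2 * Re (cnj (x k) * z k) + (cmod (z k))\<^sup>2)"
    unfolding norm2_power2 cmod_power2
    by (intro sum.cong refl) (simp add: power2_eq_square algebra_simps)
  also have "\<dots> = (norm2 fc x)\<^sup>2 - 2 * rinner fc x z + (norm2 fc z)\<^sup>2"
    by (simp add: norm2_power2 rinner_def sum.distrib sum_subtractf sum_distrib_left)
  finally show ?thesis .
qed

section \<open>Linearity of trigonometric polynomials and their sup norm\<close>

lemma trig_poly_add: "trig_poly fc (\<lambda>k. x k + z k) t = trig_poly fc x t + trig_poly fc z t"
  by (simp add: trig_poly_def distrib_right sum.distrib)

lemma trig_poly_scale: "trig_poly fc (\<lambda>k. a * x k) t = a * trig_poly fc x t"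
  by (simp add: trig_poly_def sum_distrib_left mult_ac)

lemma cmod_trig_poly_le_supnorm:
  "t \<in> torus \<Longrightarrow> cmod (trig_poly fc x t) \<le> supnorm (trig_poly fc x)"
  unfolding supnorm_def by (rule cSUP_upper[OF _ bdd_above_trig_poly])

lemma supnorm_least: "(\<And>t. t \<in> torus \<Longrightarrow> cmod (p t) \<le> B) \<Longrightarrow> supnorm p \<le> B"
  unfolding supnorm_def by (rule cSUP_least) (auto simp: torus_def)

lemma supnorm_trig_poly_nonneg: "0 \<le> supnorm (trig_poly fc x)"
  using cmod_trig_poly_le_supnorm[of 0 fc x] norm_ge_zero[of "trig_poly fc x 0"]
  by (simp add: torus_def del: norm_ge_zero)

lemma supnorm_scale_le:
  "supnorm (trig_poly fc (\<lambda>k. complex_of_real a * x k)) \<le> \<bar>a\<bar> * supnorm (trig_poly fc x)"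
  by (rule supnorm_least)
    (simp add: trig_poly_scale norm_mult mult_left_mono cmod_trig_poly_le_supnorm)

lemma supnorm_add_le:
  "supnorm (trig_poly fc (\<lambda>k. x k + z k)) \<le> supnorm (trig_poly fc x) + supnorm (trig_poly fc z)"
  by (rule supnorm_least)
    (auto simp: trig_poly_add
      intro: order_trans[OF norm_triangle_ineq] add_mono cmod_trig_poly_le_supnorm)

section \<open>Parseval on an equispaced grid\<close>

text \<open>A geometric sum with ratio \<open>w\<close>, where \<open>w ^ n = 1\<close>; the bounds
  on \<open>m\<close> prevent \<open>n\<close> from dividing it, so \<open>w\<close> differs from
  1.\<close>

lemma sum_roots_of_unity:
  fixes m :: int and n :: nat
  assumes "n > 0" and "m \<noteq> 0" and "\<bar>m\<bar> < int n"
  shows "(\<Sum>j<n. exp (2 * of_real pi * \<i> * of_int m * of_real (real j / real n))) = (0::complex)"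
proof -
  define w :: complex where "w = exp (2 * of_real pi * \<i> * of_int m / of_nat n)"
  have pow: "exp (2 * of_real pi * \<i> * of_int m * of_real (real j / real n)) = w ^ j" for j
    unfolding w_def exp_of_nat_mult[symmetric] by (simp add: field_simps)
  have "w \<noteq> 1"
  proof
    assume "w = 1"
    then obtain q :: int where q: "2 * pi * of_int m / of_nat n = of_int (2 * q) * pi"
      by (auto simp: w_def exp_eq_1)
    then have "real_of_int m = real_of_int (q * int n)"
      using assms(1) by (simp add: field_simps)
    then have "m = q * int n"
      by (simp only: of_int_eq_iff)
    with assms(2,3) show False
      by (simp add: abs_mult)
  qed
  moreover have "w ^ n = 1"
  proof -
    have "w ^ n = exp (2 * of_real pi * \<i> * of_int m)"
      using assms(1) by (simp add: w_def exp_of_nat_mult[symmetric])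
    also have "\<dots> = 1"
      using exp_integer_2pi[of "of_int m"] by (simp add: mult_ac)
    finally show ?thesis .
  qed
  ultimately show ?thesis
    unfolding pow by (subst geometric_sum) auto
qed

text \<open>Two frequencies differ by at most \<open>2 * fc\<close>, which is less than
  \<open>dimn fc\<close>, so distinct exponentials are already orthogonal on the grid of
  \<open>dimn fc\<close> points. No integral over the torus is involved.\<close>

lemma discrete_parseval:
  "(\<Sum>j<dimn fc. (cmod (trig_poly fc c (real j / real (dimn fc))))\<^sup>2)
    = real (dimn fc) * (norm2 fc c)\<^sup>2"
proof -
  define n where "n = dimn fc"
  define e where "e k j = exp (2 * of_real pi * \<i> * of_int k * of_real (real j / real n))"
    for k :: int and j :: nat
  have n: "n > 0"
    by (simp add: n_def dimn_def)
  have ee: "e k j * cnj (e m j) = e (k - m) j" for k m j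
    by (simp add: e_def exp_cnj exp_add[symmetric] algebra_simps)
  have orth: "(\<Sum>j<n. e (k - m) j) = (if k = m then of_nat n else 0)"
    if "k \<in> freqs fc" "m \<in> freqs fc" for k m
  proof (cases "k = m")
    case False
    with that have "k - m \<noteq> 0" "\<bar>k - m\<bar> < int n"
      by (auto simp: freqs_def n_def dimn_def)
    from sum_roots_of_unity[OF n this] False show ?thesis
      by (simp add: e_def)
  qed (simp add: e_def)
  have "complex_of_real (\<Sum>j<n. (cmod (trig_poly fc c (real j / real n)))\<^sup>2)
      = (\<Sum>j<n. (\<Sum>k\<in>freqs fc. c k * e k j) * cnj (\<Sum>m\<in>freqs fc. c m * e m j))"
    by (simp only: of_real_sum complex_norm_square trig_poly_def e_def)
  also have "\<dots> = (\<Sum>j<n. \<Sum>k\<in>freqs fc. \<Sum>m\<in>freqs fc. c k * cnj (c m) * e (k - m) j)"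
    by (simp add: sum_product mult_ac flip: ee)
  also have "\<dots> = (\<Sum>k\<in>freqs fc. \<Sum>j<n. \<Sum>m\<in>freqs fc. c k * cnj (c m) * e (k - m) j)"
    by (rule sum.swap)
  also have "\<dots> = (\<Sum>k\<in>freqs fc. \<Sum>m\<in>freqs fc. \<Sum>j<n. c k * cnj (c m) * e (k - m) j)"
    by (intro sum.cong refl sum.swap)
  also have "\<dots> = (\<Sum>k\<in>freqs fc. \<Sum>m\<in>freqs fc. if k = m then c k * cnj (c k) * of_nat n else 0)"
    by (intro sum.cong refl) (simp add: orth flip: sum_distrib_left)
  also have "\<dots> = (\<Sum>k\<in>freqs fc. c k * cnj (c k) * of_nat n)"
    by simp
  also have "\<dots> = complex_of_real (real n * (norm2 fc c)\<^sup>2)"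
    unfolding norm2_power2 of_real_mult of_real_sum complex_norm_square
    by (simp add: sum_distrib_left mult_ac)
  finally show ?thesis
    by (simp only: of_real_eq_iff n_def)
qed

lemma sample_in_torus: "j < dimn fc \<Longrightarrow> real j / real (dimn fc) \<in> torus"
  by (simp add: torus_def)

text \<open>The squared norm is the mean of the squared modulus over the grid, hence at most its
  supremum.\<close>

lemma norm2_le_supnorm: "norm2 fc c \<le> supnorm (trig_poly fc c)"
proof -
  have "real (dimn fc) * (norm2 fc c)\<^sup>2 \<le> (\<Sum>j<dimn fc. (supnorm (trig_poly fc c))\<^sup>2)"
    unfolding discrete_parseval[symmetric]
    by (intro sum_mono power_mono cmod_trig_poly_le_supnorm sample_in_torus) auto
  then have "(norm2 fc c)\<^sup>2 \<le> (supnorm (trig_poly fc c))\<^sup>2"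
    by (simp add: dimn_def)
  then show ?thesis
    by (rule power2_le_imp_le[OF _ supnorm_trig_poly_nonneg])
qed

text \<open>A constant squared modulus equals its mean over the grid.\<close>

lemma supnorm_eq_norm2_if_constant_modulus:
  assumes "(\<lambda>t. (cmod (trig_poly fc c t))\<^sup>2) constant_on torus"
  shows "supnorm (trig_poly fc c) = norm2 fc c"
proof -
  obtain v where v: "\<And>t. t \<in> torus \<Longrightarrow> (cmod (trig_poly fc c t))\<^sup>2 = v"
    using assms by (auto simp: constant_on_def)
  have "real (dimn fc) * (norm2 fc c)\<^sup>2 = (\<Sum>j<dimn fc. v)"
    unfolding discrete_parseval[symmetric] by (intro sum.cong refl v sample_in_torus) simp
  then have "v = (norm2 fc c)\<^sup>2"
    by (simp add: dimn_def)
  have "supnorm (trig_poly fc c) \<le> norm2 fc c"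
  proof (rule supnorm_least)
    fix t assume "t \<in> torus"
    then have "(cmod (trig_poly fc c t))\<^sup>2 \<le> (norm2 fc c)\<^sup>2"
      using v \<open>v = (norm2 fc c)\<^sup>2\<close> by simp
    then show "cmod (trig_poly fc c t) \<le> norm2 fc c"
      by (rule power2_le_imp_le) simp
  qed
  with norm2_le_supnorm show ?thesis
    by (rule antisym[rotated])
qed

text \<open>A small positive multiple of \<open>y\<close> is feasible with positive objective, so
  the zero vector is not optimal. This keeps the denominator of \<open>lambda_min\<close> away from
  0.\<close>

lemma BME_solution_norm2_pos:
  assumes "y \<in> cvecs fc" and "norm2 fc y > 0" and "BME_solution fc y b"
  shows "norm2 fc b > 0"
proof (rule ccontr)
  assume "\<not> norm2 fc b > 0"
  then have "norm2 fc b = 0"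
    using norm2_nonneg[of fc b] by linarith
  then have b0: "rinner fc y b = 0"
    by (simp add: norm2_eq_0_iff rinner_def)
  \<comment> \<open>The summand 1 makes the denominator positive without first showing that the sup
    norm is.\<close>
  define a where "a = 1 / (1 + supnorm (trig_poly fc y))"
  have a: "a > 0"
    using supnorm_trig_poly_nonneg[of fc y] by (simp add: a_def)
  have "supnorm (trig_poly fc (\<lambda>k. complex_of_real a * y k)) \<le> a * supnorm (trig_poly fc y)"
    using supnorm_scale_le[of fc a y] a by simp
  also have "\<dots> \<le> 1"
    using supnorm_trig_poly_nonneg[of fc y] by (simp add: a_def field_simps)
  finally have "\<not> rinner fc y b < rinner fc y (\<lambda>k. complex_of_real a * y k)"
    using assms(1,3) by (auto simp: BME_solution_def is_arg_max_def cvecs_def)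
  with a assms(2) show False
    by (simp add: b0 rinner_scale rinner_self)
qed

section \<open>Non-constancy of the dual polynomial\<close>

theorem proposition7:
  fixes fc :: nat and y cBME c :: "int \<Rightarrow> complex" and l :: real
  assumes "fc \<ge> 1"
    and "y \<in> cvecs fc" and "y \<noteq> (\<lambda>_. 0)"
    and "BME_solution fc y cBME"
    and "lambda_min fc cBME < l" and "l \<le> lambda_max fc y"
    and "CBLasso_dual_solution fc y l c"
  shows "\<not> (\<lambda>t. (cmod (trig_poly fc c t))\<^sup>2) constant_on torus"
proof
  assume const: "(\<lambda>t. (cmod (trig_poly fc c t))\<^sup>2) constant_on torus"
  define N where "N = sqrt (real (dimn fc))"
  define S where "S = supnorm (trig_poly fc y)"
  define Y where "Y = norm2 fc y"
  define s where "s = norm2 fc c"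
  have N: "N > 0" and N2: "N\<^sup>2 = real (dimn fc)"
    by (simp_all add: N_def dimn_def)
  have "Y \<noteq> 0"
  proof
    assume "Y = 0"
    with assms(2) have "y = (\<lambda>_. 0)"
      by (auto simp: Y_def norm2_eq_0_iff cvecs_def fun_eq_iff)
    with assms(3) show False
      by contradiction
  qed
  then have Y: "Y > 0"
    by (simp add: Y_def order_less_le)
  have b: "norm2 fc cBME > 0"
    using BME_solution_norm2_pos assms(2,4) Y by (auto simp: Y_def)
  have b1: "norm2 fc cBME \<le> 1"
    using norm2_le_supnorm[of fc cBME] assms(4)
    by (auto simp: BME_solution_def is_arg_max_def)
  \<comment> \<open>Clearing the denominator relies on \<open>b\<close>: a zero norm would give the
    threshold the default value 0. The sign of \<open>l\<close> is read off from this
    inequality.\<close>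
  have "1 < N * norm2 fc cBME * l"
    using assms(5) N b by (simp add: lambda_min_def N_def field_simps)
  also from this have l: "l > 0"
    using N b by (metis less_trans mult_pos_pos zero_less_mult_pos zero_less_one)
  have "N * norm2 fc cBME * l \<le> N * l"
    using b1 N l by simp
  finally have Nl: "N * l > 1" .
  \<comment> \<open>Radius of the ball described by the Euclidean constraint of the dual
    problem.\<close>
  define r where "r = 1 / (N * l)"
  have r: "r > 0" "r < 1"
    using Nl by (simp_all add: r_def)
  have ball: "real (dimn fc) * l\<^sup>2 * (norm2 fc x)\<^sup>2 \<le> 1 \<longleftrightarrow> norm2 fc x \<le> r" for x
  proof -
    have "real (dimn fc) * l\<^sup>2 * (norm2 fc x)\<^sup>2 = (N * l * norm2 fc x)\<^sup>2"
      by (simp add: N2 power_mult_distrib)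
    moreover have "(N * l * norm2 fc x)\<^sup>2 \<le> 1 \<longleftrightarrow> N * l * norm2 fc x \<le> 1"
      using Nl norm2_nonneg[of fc x] by (subst power_le_one_iff) auto
    ultimately show ?thesis
      using Nl by (simp add: r_def pos_le_divide_eq mult_ac)
  qed
  have c: "c \<in> cvecs fc" "s \<le> r"
    using assms(7) by (auto simp: CBLasso_dual_solution_def is_arg_max_def ball s_def)
  have opt: "rinner fc y x \<le> rinner fc y c"
    if "x \<in> cvecs fc" "supnorm (trig_poly fc x) \<le> 1" "norm2 fc x \<le> r" for x
    using assms(7) that l
    by (auto simp: CBLasso_dual_solution_def is_arg_max_def ball not_less)
  have s: "s \<ge> 0"
    by (simp add: s_def)
  have sup_c: "supnorm (trig_poly fc c) = s"
    using supnorm_eq_norm2_if_constant_modulus[OF const] by (simp add: s_def)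
  \<comment> \<open>This is \<open>lambda_max fc y / l\<close>, which the upper bound on
    \<open>l\<close> makes at least 1.\<close>
  define M where "M = r / Y * S"
  have M: "M \<ge> 1"
    using assms(6) N Y l by (simp add: lambda_max_def M_def r_def N_def S_def Y_def field_simps)
  \<comment> \<open>The maximiser of the linear objective over the whole ball of radius
    \<open>r\<close>.\<close>
  define d where "d = (\<lambda>k. complex_of_real (r / Y) * y k)"
  have sup_d: "supnorm (trig_poly fc d) \<le> M"
    using supnorm_scale_le[of fc "r / Y" y] r Y by (simp add: d_def M_def S_def)
  have norm_d: "norm2 fc d = r"
    using r Y norm2_scale[of fc "r / Y" y] by (simp add: d_def Y_def)
  \<comment> \<open>small enough that the point \<open>c + u (d - c)\<close> still satisfies the sup norm constraint\<close>
  define u where "u = (1 - s) / M"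
  have u: "u > 0" "u \<le> 1"
    using M c(2) r s by (simp_all add: u_def)
  define x where "x = (\<lambda>k. complex_of_real (1 - u) * c k + complex_of_real u * d k)"
  have "supnorm (trig_poly fc x) \<le> (1 - u) * s + u * M"
  proof -
    have "supnorm (trig_poly fc x)
        \<le> supnorm (trig_poly fc (\<lambda>k. complex_of_real (1 - u) * c k))
          + supnorm (trig_poly fc (\<lambda>k. complex_of_real u * d k))"
      unfolding x_def by (rule supnorm_add_le)
    also have "\<dots> \<le> \<bar>1 - u\<bar> * s + \<bar>u\<bar> * supnorm (trig_poly fc d)"
      using supnorm_scale_le[of fc "1 - u" c] supnorm_scale_le[of fc u d] sup_c
      by (intro add_mono) auto
    also have "\<dots> \<le> (1 - u) * s + u * M"
      using u sup_d by simp
    finally show ?thesis .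
  qed
  \<comment> \<open>By the choice of \<open>u\<close>, the product \<open>u * M\<close> is exactly
    \<open>1 - s\<close>.\<close>
  also have "\<dots> \<le> s + (1 - s)"
    using u M s by (intro add_mono mult_left_le_one_le) (auto simp: u_def)
  finally have sup_x: "supnorm (trig_poly fc x) \<le> 1"
    by simp
  have "norm2 fc x \<le> norm2 fc (\<lambda>k. complex_of_real (1 - u) * c k)
      + norm2 fc (\<lambda>k. complex_of_real u * d k)"
    unfolding x_def by (rule norm2_triangle)
  also have "\<dots> = (1 - u) * s + u * r"
    unfolding norm2_scale norm_d using u by (simp add: s_def)
  also have "\<dots> \<le> (1 - u) * r + u * r"
    using u c(2) by (intro add_mono mult_left_mono) auto
  finally have norm_x: "norm2 fc x \<le> r"
    by (simp add: algebra_simps)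
  have "x \<in> cvecs fc"
    using c(1) assms(2) by (simp add: x_def d_def cvecs_def)
  \<comment> \<open>The objective is affine along the segment from \<open>c\<close> to
    \<open>d\<close>, so comparing \<open>c\<close> with the nearby point \<open>x\<close> already
    compares it with \<open>d\<close>.\<close>
  from opt[OF this sup_x norm_x] have "u * rinner fc y d \<le> u * rinner fc y c"
    unfolding x_def rinner_add rinner_scale by (simp add: algebra_simps)
  then have "rinner fc y d \<le> rinner fc y c"
    using u by simp
  moreover have "rinner fc y d = r * Y"
    unfolding d_def rinner_scale rinner_self Y_def[symmetric]
    using Y by (simp add: power2_eq_square)
  ultimately have yc: "r * Y \<le> rinner fc y c"
    by simp
  have "rinner fc d c = r / Y * rinner fc y c"
  proof -
    have "rinner fc d c = rinner fc y (\<lambda>k. complex_of_real (r / Y) * c k)"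
      by (simp add: rinner_def d_def mult_ac)
    then show ?thesis
      by (simp only: rinner_scale)
  qed
  moreover have "r\<^sup>2 = r / Y * (r * Y)"
    using Y by (simp add: power2_eq_square)
  \<comment> \<open>Together with \<open>s \<le> r\<close>, the squared distance from
    \<open>d\<close> to \<open>c\<close> is at most \<open>r^2 - 2 * r^2 + r^2 = 0\<close>.\<close>
  ultimately have "r\<^sup>2 \<le> rinner fc d c"
    using yc r Y by (simp only:) (intro mult_left_mono, auto)
  moreover have "s\<^sup>2 \<le> r\<^sup>2"
    using c(2) s by (rule power_mono)
  ultimately have "(norm2 fc (\<lambda>k. d k - c k))\<^sup>2 \<le> 0"
    by (simp add: norm2_diff_power2 norm_d s_def)
  then have "\<forall>k\<in>freqs fc. d k = c k"
    by (simp add: norm2_eq_0_iff)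
  \<comment> \<open>Since \<open>c\<close> agrees with \<open>d\<close>, \<open>y\<close> is a
    multiple of \<open>c\<close>. Its sup norm is therefore controlled by \<open>s\<close>, giving
    \<open>M \<le> s \<le> r < 1\<close> against \<open>M \<ge> 1\<close>.\<close>
  then have "y k = complex_of_real (Y / r) * c k" if "k \<in> freqs fc" for k
    using that r Y by (simp add: d_def field_simps)
  then have "trig_poly fc y = trig_poly fc (\<lambda>k. complex_of_real (Y / r) * c k)"
    by (intro ext) (simp add: trig_poly_def)
  then have "S \<le> Y / r * s"
    using supnorm_scale_le[of fc "Y / r" c] r Y sup_c by (simp add: S_def)
  then have "M \<le> r / Y * (Y / r * s)"
    unfolding M_def using r Y by (intro mult_left_mono) auto
  also have "\<dots> = s"
    using r Y by simp
  finally show False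
    using M c(2) r by simp
qed

end
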